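(* Let $(S,\mathcal{B}(S))$ be a measurable state space, let $(B_n)_{n\ge 0}$ be the time-homogeneous Markov chain on $S$ defined by $B_{n+1}=\Phi(B_n,Y_{n+1})$, $B_0=b_0$, with Markov transition kernel $\kappa:S\times\mathcal{B}(S)\to[0,1]$, $\kappa(s,A)=\mathbb{P}\{\Phi(s,Y)\in A\}$, and let $\Pi_n(A)=\mathbb{P}(B_n\in A)$ be the law of $B_n$. Then, for every $n\ge 0$ and every Borel set $A\subseteq S$, $$\Pi_{n+1}(A)=(\Pi_n\kappa)(A)=\int_S \kappa(s,A)\,\Pi_n(\mathrm{d}s).$$ Moreover, when $S\subseteq\mathbb{R}$, setting $G_n(b):=\Pi_n((-\infty,b])$ and $F_\kappa(b|s):=\kappa(s,(-\infty,b])$, the cumulative distribution function satisfies $$G_{n+1}(b)=\int_S F_\kappa(b|s)\,\Pi_n(\mathrm{d}s).$$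
   Context: $(Y_n)_{n\ge1}$ is a sequence of independent identically distributed real random variables on a probability space $(\Omega,\mathcal{F},\mathbb{P})$, and $Y$ denotes a generic random variable with their common law. $S$ is a fixed measurable state space with Borel sigma-algebra $\mathcal{B}(S)$, and $\Phi:S\times\mathbb{R}\to S$ is a measurable map (so $\Phi(s,y)\in S$ for all $(s,y)\in S\times\mathbb{R}$). The initial value $b_0\in S$ is given. For a finite measure $\mu$ on $S$, the measure $\mu\kappa$ is defined by $(\mu\kappa)(A):=\int_S\kappa(s,A)\,\mu(\mathrm{d}s)$. When $S\subseteq\mathbb{R}$, the notation $(-\infty,b]$ as a subset of $S$ means $(-\infty,b]\cap S$. *)

theory Defs
  imports "HOL-Probability.Probability"
begin

text \<open>A measurable space \<open>(S, \<B>(S))\<close> is given as a value \<open>S\<close> of type \<open>'s measure\<close>, of which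
  only \<open>space S\<close> and \<open>sets S\<close> matter. In the driving sequence only the entries with index at
  least 1 are used.\<close>

primrec chain :: "('s \<times> real \<Rightarrow> 's) \<Rightarrow> (nat \<Rightarrow> 'w \<Rightarrow> real) \<Rightarrow> 's \<Rightarrow> nat \<Rightarrow> 'w \<Rightarrow> 's" where
  "chain \<Phi> Ys b0 0 \<omega> = b0"
| "chain \<Phi> Ys b0 (Suc n) \<omega> = \<Phi> (chain \<Phi> Ys b0 n \<omega>, Ys (Suc n) \<omega>)"

definition chain_law ::
  "'w measure \<Rightarrow> 's measure \<Rightarrow> ('s \<times> real \<Rightarrow> 's) \<Rightarrow> (nat \<Rightarrow> 'w \<Rightarrow> real) \<Rightarrow> 's \<Rightarrow> nat \<Rightarrow> 's measure" where
  "chain_law M S \<Phi> Ys b0 n = distr M S (chain \<Phi> Ys b0 n)"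

definition trans_kernel ::
  "'w measure \<Rightarrow> ('s \<times> real \<Rightarrow> 's) \<Rightarrow> ('w \<Rightarrow> real) \<Rightarrow> 's \<Rightarrow> 's set \<Rightarrow> real" where
  "trans_kernel M \<Phi> Y s A = measure M {\<omega> \<in> space M. \<Phi> (s, Y \<omega>) \<in> A}"

text \<open>The measure \<open>\<mu>\<kappa>\<close>, with \<open>(\<mu>\<kappa>)(A) = \<integral> \<kappa>(s, A) \<mu>(ds)\<close> on the sigma-algebra of \<open>\<mu>\<close>.
  \<^const>\<open>measure_of\<close> takes this value on measurable sets only when the set function is countably
  additive (it is the null measure otherwise), as is the case for a Markov kernel \<open>\<kappa>\<close>.\<close>

definition kernel_comp :: "'s measure \<Rightarrow> ('s \<Rightarrow> 's set \<Rightarrow> real) \<Rightarrow> 's measure" where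
  "kernel_comp \<mu> \<kappa> = measure_of (space \<mu>) (sets \<mu>) (\<lambda>A. \<integral>\<^sup>+ s. ennreal (\<kappa> s A) \<partial>\<mu>)"

text \<open>For \<open>X \<subseteq> \<real>\<close>, the half-line \<open>(-\<infinity>, b]\<close> as a subset of the state space is \<open>{..b} \<inter> X\<close>, and the
  Borel sigma-algebra of \<open>X\<close> is the trace \<open>restrict_space borel X\<close>.\<close>

definition chain_cdf ::
  "'w measure \<Rightarrow> real set \<Rightarrow> (real \<times> real \<Rightarrow> real) \<Rightarrow> (nat \<Rightarrow> 'w \<Rightarrow> real) \<Rightarrow> real \<Rightarrow> nat \<Rightarrow> real \<Rightarrow> real" where
  "chain_cdf M X \<Phi> Ys b0 n b = measure (chain_law M (restrict_space borel X) \<Phi> Ys b0 n) ({..b} \<inter> X)"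

definition kernel_cdf :: "(real \<Rightarrow> real set \<Rightarrow> real) \<Rightarrow> real set \<Rightarrow> real \<Rightarrow> real \<Rightarrow> real" where
  "kernel_cdf \<kappa> X b s = \<kappa> s ({..b} \<inter> X)"

end

theory Submission
  imports Defs
begin

text \<open>The value \<open>B\<^sub>n\<close> is a measurable function of \<open>Y\<^sub>1, \<dots>, Y\<^sub>n\<close> and hence independent of
  \<open>Y\<^sub>n\<^sub>+\<^sub>1\<close>, so the joint law of \<open>(B\<^sub>n, Y\<^sub>n\<^sub>+\<^sub>1)\<close> is the product of \<open>\<Pi>\<^sub>n\<close> and the law of \<open>Y\<close>. Evaluating
  this product measure on the preimage of \<open>A\<close> under \<open>\<Phi>\<close> by Fubini gives the recursion.\<close>

lemma chain_Suc: "chain \<Phi> Ys b0 (Suc n) = (\<lambda>\<omega>. \<Phi> (chain \<Phi> Ys b0 n \<omega>, Ys (Suc n) \<omega>))"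
  by auto

text \<open>Only the entries with index 1 to \<open>n\<close> enter \<open>B_n\<close>. This allows
  the driving sequence to be replaced by coordinates of a path restricted to
  \<open>{1..n}\<close>.\<close>

lemma chain_cong:
  assumes "\<And>i. i \<in> {1..n} \<Longrightarrow> Ys i \<omega> = Ys' i \<omega>'"
  shows "chain \<Phi> Ys b0 n \<omega> = chain \<Phi> Ys' b0 n \<omega>'"
  using assms by (induction n) auto

text \<open>The domain \<open>N\<close> is kept arbitrary for two uses: the sample space
  \<open>M\<close>, and the product space of paths over \<open>{1..n}\<close>.\<close>

lemma measurable_chain:
  assumes \<Phi>: "\<Phi> \<in> S \<Otimes>\<^sub>M borel \<rightarrow>\<^sub>M S" and b0: "b0 \<in> space S"
    and Ys: "\<And>i. i \<in> {1..n} \<Longrightarrow> Ys i \<in> borel_measurable N"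
  shows "chain \<Phi> Ys b0 n \<in> N \<rightarrow>\<^sub>M S"
  using Ys
proof (induction n)
  case 0
  then show ?case using b0 by simp
next
  case (Suc n)
  then have [measurable]: "chain \<Phi> Ys b0 n \<in> N \<rightarrow>\<^sub>M S" "Ys (Suc n) \<in> borel_measurable N"
    by simp_all
  note \<Phi>[measurable]
  have "(\<lambda>\<omega>. \<Phi> (chain \<Phi> Ys b0 n \<omega>, Ys (Suc n) \<omega>)) \<in> N \<rightarrow>\<^sub>M S"
    by measurable
  then show ?case by (simp only: chain_Suc)
qed

text \<open>This puts the kernel in the form in which Fubini and the measurability of sections
  apply. For \<open>s\<close> in \<open>space S\<close>, intersecting the preimage with the product
  space removes nothing from its section at \<open>s\<close>.\<close>

lemma trans_kernel_eq_section:
  assumes \<Phi>: "\<Phi> \<in> S \<Otimes>\<^sub>M borel \<rightarrow>\<^sub>M S" and Y: "Y \<in> borel_measurable M"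
    and s: "s \<in> space S" and A: "A \<in> sets S"
  shows "trans_kernel M \<Phi> Y s A =
    measure (distr M borel Y) (Pair s -` (\<Phi> -` A \<inter> space (S \<Otimes>\<^sub>M borel)))"
proof -
  have "Pair s -` (\<Phi> -` A \<inter> space (S \<Otimes>\<^sub>M borel)) \<in> sets borel"
    using measurable_sets[OF \<Phi> A] by (rule sets_Pair1)
  moreover have "{\<omega> \<in> space M. \<Phi> (s, Y \<omega>) \<in> A} =
      Y -` (Pair s -` (\<Phi> -` A \<inter> space (S \<Otimes>\<^sub>M borel))) \<inter> space M"
    using s by (auto simp: space_pair_measure)
  ultimately show ?thesis
    using Y by (simp add: trans_kernel_def measure_distr)
qed

lemma measure_pair_section_measurable:
  assumes "sigma_finite_measure N" "E \<in> sets (S \<Otimes>\<^sub>M N)"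
  shows "(\<lambda>s. measure N (Pair s -` E)) \<in> borel_measurable S"
  unfolding measure_def
  using sigma_finite_measure.measurable_emeasure_Pair[OF assms] by measurable

text \<open>The constant \<^const>\<open>prob_space.indep_var\<close> forces both variables to take values in the same
  type. Stating the conclusion for images \<open>f \<circ> X\<close>, \<open>g \<circ> Z\<close> frees the value types.\<close>

lemma (in prob_space) indep_var_distr_pair_compose:
  assumes ind: "indep_var S X T Z" and f: "f \<in> S \<rightarrow>\<^sub>M S'" and g: "g \<in> T \<rightarrow>\<^sub>M T'"
  shows "distr M (S' \<Otimes>\<^sub>M T') (\<lambda>\<omega>. (f (X \<omega>), g (Z \<omega>))) =
    distr M S' (\<lambda>\<omega>. f (X \<omega>)) \<Otimes>\<^sub>M distr M T' (\<lambda>\<omega>. g (Z \<omega>))"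
proof -
  note X = indep_var_rv1[OF ind] and Z = indep_var_rv2[OF ind]
  \<comment> \<open>This supplies the sigma-finiteness of the second factor that
    \<open>pair_measure_distr\<close> asks for.\<close>
  interpret D: prob_space "distr M T' (\<lambda>\<omega>. g (Z \<omega>))"
    by (rule prob_space_distr) (rule measurable_compose[OF Z g])
  have g_law: "distr (distr M T Z) T' g = distr M T' (\<lambda>\<omega>. g (Z \<omega>))"
    by (simp add: distr_distr[OF g Z] comp_def)
  have f_law: "distr (distr M S X) S' f = distr M S' (\<lambda>\<omega>. f (X \<omega>))"
    by (simp add: distr_distr[OF f X] comp_def)
  have "(\<lambda>(x, y). (f x, g y)) \<in> S \<Otimes>\<^sub>M T \<rightarrow>\<^sub>M S' \<Otimes>\<^sub>M T'"
    using f g by measurable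
  then have "distr M (S' \<Otimes>\<^sub>M T') (\<lambda>\<omega>. (f (X \<omega>), g (Z \<omega>))) =
      distr (distr M (S \<Otimes>\<^sub>M T) (\<lambda>\<omega>. (X \<omega>, Z \<omega>))) (S' \<Otimes>\<^sub>M T') (\<lambda>(x, y). (f x, g y))"
    using X Z by (simp add: distr_distr comp_def)
  also have "\<dots> = distr (distr M S X \<Otimes>\<^sub>M distr M T Z) (S' \<Otimes>\<^sub>M T') (\<lambda>(x, y). (f x, g y))"
    using ind by (simp add: indep_var_distribution_eq)
  also have "\<dots> = distr (distr M S X) S' f \<Otimes>\<^sub>M distr (distr M T Z) T' g"
    by (rule pair_measure_distr[symmetric])
      (use f g D.sigma_finite_measure_axioms in \<open>simp_all add: g_law\<close>)
  finally show ?thesis by (simp add: f_law g_law)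
qed

text \<open>The state space is a parameter, so that both halves of the theorem are instances: an
  arbitrary \<open>S\<close>, and the trace \<open>restrict_space borel X\<close>.\<close>

locale driven_chain = prob_space M for M :: "'w measure" +
  fixes Ys :: "nat \<Rightarrow> 'w \<Rightarrow> real" and Y :: "'w \<Rightarrow> real"
    and S :: "'s measure" and \<Phi> :: "'s \<times> real \<Rightarrow> 's" and b0 :: 's
  assumes indep: "indep_vars (\<lambda>_. borel) Ys {1..}"
    and Y_measurable: "Y \<in> borel_measurable M"
    and same_law: "n \<ge> 1 \<Longrightarrow> distr M borel (Ys n) = distr M borel Y"
    and \<Phi>_measurable: "\<Phi> \<in> S \<Otimes>\<^sub>M borel \<rightarrow>\<^sub>M S"
    and b0: "b0 \<in> space S"
begin

lemma Ys_measurable: "Ys (Suc n) \<in> borel_measurable M"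
  using indep by (simp add: indep_vars_def)

lemma chain_measurable: "chain \<Phi> Ys b0 n \<in> M \<rightarrow>\<^sub>M S"
  by (rule measurable_chain[OF \<Phi>_measurable b0]) (use indep in \<open>simp add: indep_vars_def\<close>)

lemma prob_space_chain_law: "prob_space (chain_law M S \<Phi> Ys b0 n)"
  unfolding chain_law_def by (rule prob_space_distr[OF chain_measurable])

lemma sets_chain_law [simp]: "sets (chain_law M S \<Phi> Ys b0 n) = sets S"
  and space_chain_law [simp]: "space (chain_law M S \<Phi> Ys b0 n) = space S"
  by (simp_all add: chain_law_def)

lemma joint_law:
  "distr M (S \<Otimes>\<^sub>M borel) (\<lambda>\<omega>. (chain \<Phi> Ys b0 n \<omega>, Ys (Suc n) \<omega>)) =
    chain_law M S \<Phi> Ys b0 n \<Otimes>\<^sub>M distr M borel Y"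
proof -
  \<comment> \<open>Restrictions to the disjoint blocks \<open>{1..n}\<close> and
    \<open>{Suc n}\<close> are both paths of type \<open>nat \<Rightarrow> real\<close>, as
    \<open>indep_var\<close> requires.\<close>
  let ?R = "\<lambda>A \<omega>. restrict (\<lambda>i. Ys i \<omega>) A"
  have ind: "indep_var (\<Pi>\<^sub>M i\<in>{1..n}. borel) (?R {1..n}) (\<Pi>\<^sub>M i\<in>{Suc n}. borel) (?R {Suc n})"
    by (rule indep_var_restrict[OF indep]) auto
  \<comment> \<open>Driving the chain by the coordinate maps yields the deterministic function that
    sends a path to \<open>B_n\<close>. For \<open>n = 0\<close> the block is empty and the function
    is the constant \<open>b0\<close>.\<close>
  have "chain \<Phi> (\<lambda>i f. f i) b0 n \<in> (\<Pi>\<^sub>M i\<in>{1..n}. borel) \<rightarrow>\<^sub>M S"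
    by (rule measurable_chain[OF \<Phi>_measurable b0]) simp
  moreover have "(\<lambda>f. f (Suc n)) \<in> (\<Pi>\<^sub>M i\<in>{Suc n}. borel) \<rightarrow>\<^sub>M (borel :: real measure)"
    by simp
  moreover have "chain \<Phi> (\<lambda>i f. f i) b0 n (?R {1..n} \<omega>) = chain \<Phi> Ys b0 n \<omega>" for \<omega>
    by (rule chain_cong) simp
  ultimately show ?thesis
    using indep_var_distr_pair_compose[OF ind, of "chain \<Phi> (\<lambda>i f. f i) b0 n" S "\<lambda>f. f (Suc n)" borel]
      same_law[of "Suc n"]
    by (simp add: chain_law_def)
qed

text \<open>The next law is the image of the joint law under \<open>\<Phi>\<close>. The nonnegative
  integral is used first because it is the set function inside \<open>kernel_comp\<close>.\<close>

lemma emeasure_chain_law_Suc: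
  assumes A: "A \<in> sets S"
  shows "emeasure (chain_law M S \<Phi> Ys b0 (Suc n)) A =
    (\<integral>\<^sup>+ s. ennreal (trans_kernel M \<Phi> Y s A) \<partial>chain_law M S \<Phi> Ys b0 n)"
proof -
  let ?L = "chain_law M S \<Phi> Ys b0 n" and ?D = "distr M borel Y"
  let ?E = "\<Phi> -` A \<inter> space (S \<Otimes>\<^sub>M borel)"
  interpret D: prob_space ?D by (rule prob_space_distr[OF Y_measurable])
  have E: "?E \<in> sets (S \<Otimes>\<^sub>M borel)" by (rule measurable_sets[OF \<Phi>_measurable A])
  then have E': "?E \<in> sets (?L \<Otimes>\<^sub>M ?D)"
    by (simp cong: sets_pair_measure_cong)
  have pair: "(\<lambda>\<omega>. (chain \<Phi> Ys b0 n \<omega>, Ys (Suc n) \<omega>)) \<in> M \<rightarrow>\<^sub>M S \<Otimes>\<^sub>M borel"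
    using chain_measurable Ys_measurable by simp
  have "chain_law M S \<Phi> Ys b0 (Suc n) =
      distr (distr M (S \<Otimes>\<^sub>M borel) (\<lambda>\<omega>. (chain \<Phi> Ys b0 n \<omega>, Ys (Suc n) \<omega>))) S \<Phi>"
    by (simp add: distr_distr[OF \<Phi>_measurable pair] chain_law_def comp_def chain_Suc)
  then have "emeasure (chain_law M S \<Phi> Ys b0 (Suc n)) A =
      emeasure (distr M (S \<Otimes>\<^sub>M borel) (\<lambda>\<omega>. (chain \<Phi> Ys b0 n \<omega>, Ys (Suc n) \<omega>))) ?E"
    using \<Phi>_measurable A by (simp add: emeasure_distr)
  also have "\<dots> = (\<integral>\<^sup>+ s. emeasure ?D (Pair s -` ?E) \<partial>?L)"
    unfolding joint_law by (rule D.emeasure_pair_measure_alt[OF E'])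
  also have "\<dots> = (\<integral>\<^sup>+ s. ennreal (trans_kernel M \<Phi> Y s A) \<partial>?L)"
    by (rule nn_integral_cong)
      (simp add: trans_kernel_eq_section[OF \<Phi>_measurable Y_measurable _ A] D.emeasure_eq_measure)
  finally show ?thesis .
qed

text \<open>On \<open>sets S\<close> the set function defining \<open>kernel_comp\<close> agrees
  with the \<open>emeasure\<close> of the next law. It is therefore countably additive, and
  \<open>measure_of\<close> does not fall back to the null measure.\<close>

lemma kernel_comp_chain_law:
  "kernel_comp (chain_law M S \<Phi> Ys b0 n) (trans_kernel M \<Phi> Y) = chain_law M S \<Phi> Ys b0 (Suc n)"
proof -
  have "kernel_comp (chain_law M S \<Phi> Ys b0 n) (trans_kernel M \<Phi> Y) =
      measure_of (space S) (sets S) (emeasure (chain_law M S \<Phi> Ys b0 (Suc n)))"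
    unfolding kernel_comp_def space_chain_law sets_chain_law
    by (rule measure_of_eq)
      (auto simp: sets.space_closed sets.sigma_sets_eq emeasure_chain_law_Suc)
  also have "\<dots> = chain_law M S \<Phi> Ys b0 (Suc n)"
    using measure_of_of_measure[of "chain_law M S \<Phi> Ys b0 (Suc n)"] by simp
  finally show ?thesis .
qed

text \<open>The kernel takes values in [0,1] and the law is a probability measure, so measurability
  in \<open>s\<close> suffices; it comes from the sections. Integrability rules out the default
  value 0 of the Bochner integral.\<close>

lemma integrable_trans_kernel:
  assumes A: "A \<in> sets S"
  shows "integrable (chain_law M S \<Phi> Ys b0 n) (\<lambda>s. trans_kernel M \<Phi> Y s A)"
proof -
  interpret L: prob_space "chain_law M S \<Phi> Ys b0 n" by (rule prob_space_chain_law)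
  interpret D: prob_space "distr M borel Y" by (rule prob_space_distr[OF Y_measurable])
  have "\<Phi> -` A \<inter> space (S \<Otimes>\<^sub>M borel) \<in> sets (S \<Otimes>\<^sub>M distr M borel Y)"
    using measurable_sets[OF \<Phi>_measurable A] by (simp cong: sets_pair_measure_cong)
  then have "(\<lambda>s. measure (distr M borel Y) (Pair s -` (\<Phi> -` A \<inter> space (S \<Otimes>\<^sub>M borel))))
      \<in> borel_measurable S"
    by (rule measure_pair_section_measurable[OF D.sigma_finite_measure_axioms])
  then have "(\<lambda>s. trans_kernel M \<Phi> Y s A) \<in> borel_measurable S"
    by (subst measurable_cong[OF trans_kernel_eq_section[OF \<Phi>_measurable Y_measurable _ A]])
  then have "(\<lambda>s. trans_kernel M \<Phi> Y s A) \<in> borel_measurable (chain_law M S \<Phi> Ys b0 n)"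
    by (simp add: chain_law_def)
  then show ?thesis
    by (intro L.integrable_const_bound[where B = 1]) (auto simp: trans_kernel_def)
qed

lemma measure_chain_law_Suc:
  assumes A: "A \<in> sets S"
  shows "measure (chain_law M S \<Phi> Ys b0 (Suc n)) A =
    (\<integral>s. trans_kernel M \<Phi> Y s A \<partial>chain_law M S \<Phi> Ys b0 n)"
  \<comment> \<open>\<open>measure\<close> is \<open>enn2real\<close> of \<open>emeasure\<close>,
    and the Bochner integral of a nonnegative measurable function is \<open>enn2real\<close> of its
    nonnegative integral.\<close>
  unfolding measure_def emeasure_chain_law_Suc[OF A]
  by (rule integral_eq_nn_integral[symmetric])
    (use integrable_trans_kernel[OF A] in \<open>auto simp: trans_kernel_def\<close>)

end

theorem lemma2p1:
  fixes M :: "'w measure" and Ys :: "nat \<Rightarrow> 'w \<Rightarrow> real" and Y :: "'w \<Rightarrow> real"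
  assumes "prob_space M"
    and "prob_space.indep_vars M (\<lambda>_. borel) Ys {1..}"
    and "Y \<in> borel_measurable M"
    and "\<And>n. n \<ge> 1 \<Longrightarrow> distr M borel (Ys n) = distr M borel Y"
  shows
    "(\<forall>(S :: 's measure) \<Phi> b0.
        \<Phi> \<in> S \<Otimes>\<^sub>M borel \<rightarrow>\<^sub>M S \<longrightarrow> b0 \<in> space S \<longrightarrow>
        (\<forall>n. \<forall>A \<in> sets S.
           integrable (chain_law M S \<Phi> Ys b0 n) (\<lambda>s. trans_kernel M \<Phi> Y s A) \<and>
           measure (chain_law M S \<Phi> Ys b0 (Suc n)) A =
             measure (kernel_comp (chain_law M S \<Phi> Ys b0 n) (trans_kernel M \<Phi> Y)) A \<and>
           measure (kernel_comp (chain_law M S \<Phi> Ys b0 n) (trans_kernel M \<Phi> Y)) A =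
             (\<integral>s. trans_kernel M \<Phi> Y s A \<partial>chain_law M S \<Phi> Ys b0 n)))
     \<and>
     (\<forall>(X :: real set) \<Phi> b0.
        \<Phi> \<in> restrict_space borel X \<Otimes>\<^sub>M borel \<rightarrow>\<^sub>M restrict_space borel X \<longrightarrow> b0 \<in> X \<longrightarrow>
        (\<forall>n b.
           integrable (chain_law M (restrict_space borel X) \<Phi> Ys b0 n)
             (kernel_cdf (trans_kernel M \<Phi> Y) X b) \<and>
           chain_cdf M X \<Phi> Ys b0 (Suc n) b =
             (\<integral>s. kernel_cdf (trans_kernel M \<Phi> Y) X b s
                \<partial>chain_law M (restrict_space borel X) \<Phi> Ys b0 n)))"
proof -
  note driven = driven_chain.intro[OF assms(1) driven_chain_axioms.intro[OF assms(2-4)]]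
  show ?thesis
  proof (intro conjI allI impI ballI)
    fix S :: "'s measure" and \<Phi> :: "'s \<times> real \<Rightarrow> 's" and b0 n A
    assume "\<Phi> \<in> S \<Otimes>\<^sub>M borel \<rightarrow>\<^sub>M S" "b0 \<in> space S" and A: "A \<in> sets S"
    then interpret driven_chain M Ys Y S \<Phi> b0 by (intro driven)
    show "integrable (chain_law M S \<Phi> Ys b0 n) (\<lambda>s. trans_kernel M \<Phi> Y s A)"
      by (rule integrable_trans_kernel[OF A])
    show "measure (chain_law M S \<Phi> Ys b0 (Suc n)) A =
        measure (kernel_comp (chain_law M S \<Phi> Ys b0 n) (trans_kernel M \<Phi> Y)) A"
      by (simp add: kernel_comp_chain_law)
    show "measure (kernel_comp (chain_law M S \<Phi> Ys b0 n) (trans_kernel M \<Phi> Y)) A =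
        (\<integral>s. trans_kernel M \<Phi> Y s A \<partial>chain_law M S \<Phi> Ys b0 n)"
      unfolding kernel_comp_chain_law by (rule measure_chain_law_Suc[OF A])
  next
    fix X :: "real set" and \<Phi> :: "real \<times> real \<Rightarrow> real" and b0 n and b :: real
    let ?S = "restrict_space borel X"
    assume "\<Phi> \<in> ?S \<Otimes>\<^sub>M borel \<rightarrow>\<^sub>M ?S" "b0 \<in> X"
    then interpret driven_chain M Ys Y ?S \<Phi> b0 by (intro driven) (auto simp: space_restrict_space)
    \<comment> \<open>The set is the trace on \<open>X\<close> of a closed half-line, so the claims
      on distribution functions are the general ones for this \<open>A\<close>.\<close>
    have A: "{..b} \<inter> X \<in> sets ?S" by (auto simp: sets_restrict_space)
    show "integrable (chain_law M ?S \<Phi> Ys b0 n) (kernel_cdf (trans_kernel M \<Phi> Y) X b)"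
      using integrable_trans_kernel[OF A] by (simp add: kernel_cdf_def[abs_def])
    show "chain_cdf M X \<Phi> Ys b0 (Suc n) b =
        (\<integral>s. kernel_cdf (trans_kernel M \<Phi> Y) X b s \<partial>chain_law M ?S \<Phi> Ys b0 n)"
      unfolding chain_cdf_def kernel_cdf_def by (rule measure_chain_law_Suc[OF A])
  qed
qed

end
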